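(* Let $\alpha\ge 1$ and $C>0$ be real numbers. Let $\{f_n\}_n$ be a sequence of meromorphic functions in a domain $D\subseteq\mathbb{C}$ satisfying $$\frac{|f_n'|}{1+|f_n|^\alpha}(z)\ge C\qquad\text{for all } z\in D \text{ and all } n\in\mathbb{N}.$$ Let $z_0\in D$. If there exists a sequence $\{p_n\}_n$ in $D$ such that $\lim_{n\to\infty} p_n=z_0$ and $f_n(p_n)=\infty$ for all $n$, then $\{f_n\}_n$ is normal at $z_0$.
   Context: A domain is a nonempty connected open subset of $\mathbb{C}$. The condition $f_n(p_n)=\infty$ means that $p_n$ is a pole of $f_n$. At a pole of $f_n$, the value of the quotient $\frac{|f_n'|}{1+|f_n|^\alpha}$ is understood as its limit in $[0,\infty]$. A family of meromorphic functions is normal in a domain if every sequence in the family has a subsequence which converges locally uniformly in that domain with respect to the spherical metric (the limit function is allowed to be identically $\infty$). It is normal at a point $z_0$ if it is normal in some open disk centered at $z_0$ and contained in $D$. *)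

theory Defs
  imports "HOL-Complex_Analysis.Complex_Analysis"
begin

datatype riemann_sphere = Finite complex | Infinity

text \<open>Stereographic projection from the north pole onto the unit sphere of
  \<^typ>\<open>complex \<times> real\<close>.\<close>

fun stereographic :: "riemann_sphere \<Rightarrow> complex \<times> real" where
  "stereographic (Finite z) =
     ((2 / (1 + (norm z)\<^sup>2)) *\<^sub>R z, ((norm z)\<^sup>2 - 1) / ((norm z)\<^sup>2 + 1))"
| "stereographic Infinity = (0, 1)"

lemma norm_stereographic [simp]: "norm (stereographic p) = 1"
proof (cases p)
  case (Finite z)
  have pos: "1 + (norm z)\<^sup>2 > 0"
    by (simp add: add_pos_nonneg)
  then have "(2 / (1 + (norm z)\<^sup>2) * norm z)\<^sup>2 + (((norm z)\<^sup>2 - 1) / ((norm z)\<^sup>2 + 1))\<^sup>2 = 1"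
    by (simp add: power_divide power_mult_distrib divide_simps)
       (simp add: power2_eq_square algebra_simps)
  with Finite pos show ?thesis
    by (simp add: norm_Pair power_divide)
qed simp

lemma stereographic_eq_iff: "stereographic p = stereographic q \<longleftrightarrow> p = q"
proof
  assume eq: "stereographic p = stereographic q"
  have pos: "(norm w)\<^sup>2 + 1 > 0" for w :: complex
    by (simp add: add_nonneg_pos)
  have ne: "((norm w)\<^sup>2 - 1) / ((norm w)\<^sup>2 + 1) \<noteq> 1" for w :: complex
    using pos[of w] by (simp add: divide_simps)
  show "p = q"
  proof (cases p; cases q)
    fix z w assume pq: "p = Finite z" "q = Finite w"
    from eq pq have "((norm z)\<^sup>2 - 1) / ((norm z)\<^sup>2 + 1) = ((norm w)\<^sup>2 - 1) / ((norm w)\<^sup>2 + 1)"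
      by simp
    then have "((norm z)\<^sup>2 - 1) * ((norm w)\<^sup>2 + 1) = ((norm w)\<^sup>2 - 1) * ((norm z)\<^sup>2 + 1)"
      using pos[of z] pos[of w] by (simp add: frac_eq_eq)
    then have "(norm z)\<^sup>2 = (norm w)\<^sup>2"
      by (simp add: algebra_simps)
    moreover have "(2 / (1 + (norm z)\<^sup>2)) *\<^sub>R z = (2 / (1 + (norm w)\<^sup>2)) *\<^sub>R w"
      using eq pq by simp
    moreover have "2 / (1 + (norm w)\<^sup>2) \<noteq> 0"
      using pos[of w] by (simp add: add.commute)
    ultimately show "p = q"
      using pq by simp
  qed (use eq ne ne[symmetric] in simp_all)
qed simp

lemma arccos_inner_triangle:
  fixes x y z :: "'a :: real_inner"
  assumes "norm x = 1" "norm y = 1" "norm z = 1"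
  shows "arccos (x \<bullet> z) \<le> arccos (x \<bullet> y) + arccos (y \<bullet> z)"
proof -
  define a b where "a = x \<bullet> y" and "b = y \<bullet> z"
  have bd: "\<bar>u \<bullet> v\<bar> \<le> 1" if "norm u = 1" "norm v = 1" for u v :: 'a
    using Cauchy_Schwarz_ineq2[of u v] that by simp
  have ab: "\<bar>a\<bar> \<le> 1" "\<bar>b\<bar> \<le> 1" "\<bar>x \<bullet> z\<bar> \<le> 1"
    using assms by (auto simp: a_def b_def intro: bd)
  have unit: "x \<bullet> x = 1" "y \<bullet> y = 1" "z \<bullet> z = 1"
    using assms by (simp_all add: dot_square_norm)
  have ge0: "0 \<le> arccos a" "0 \<le> arccos b"
    using ab by (auto intro!: arccos_lbound)
  have nx: "norm (x - a *\<^sub>R y) = sqrt (1 - a\<^sup>2)"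
    using unit unfolding norm_eq_sqrt_inner
    by (simp add: a_def inner_simps inner_commute[of y x] power2_eq_square)
  have nz: "norm (z - b *\<^sub>R y) = sqrt (1 - b\<^sup>2)"
    using unit unfolding norm_eq_sqrt_inner
    by (simp add: b_def inner_simps inner_commute[of z y] power2_eq_square)
  have "(x - a *\<^sub>R y) \<bullet> (z - b *\<^sub>R y) = x \<bullet> z - a * b"
    using unit by (simp add: a_def b_def inner_simps)
  then have "x \<bullet> z - a * b \<ge> - (sqrt (1 - a\<^sup>2) * sqrt (1 - b\<^sup>2))"
    using Cauchy_Schwarz_ineq2[of "x - a *\<^sub>R y" "z - b *\<^sub>R y"] nx nz by simp
  then have ineq: "cos (arccos a + arccos b) \<le> x \<bullet> z"
    using ab by (simp add: cos_add cos_arccos_abs sin_arccos_abs)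
  show ?thesis
  proof (cases "arccos a + arccos b \<le> pi")
    case True
    then have "arccos (x \<bullet> z) \<le> arccos (cos (arccos a + arccos b))"
      using ineq ab by (intro arccos_le_arccos) auto
    also have "\<dots> = arccos a + arccos b"
      using True ge0 by (intro arccos_cos) auto
    finally show ?thesis by (simp add: a_def b_def)
  next
    case False
    moreover have "arccos (x \<bullet> z) \<le> pi"
      using ab by (intro arccos_ubound) auto
    ultimately show ?thesis by (simp add: a_def b_def)
  qed
qed

text \<open>The metric is the great-circle distance on the unit sphere.\<close>

instantiation riemann_sphere :: metric_space
begin

definition dist_riemann_sphere_def:
  "dist p q = arccos (stereographic p \<bullet> stereographic q)"

definition uniformity_riemann_sphere_def:
  "(uniformity :: (riemann_sphere \<times> riemann_sphere) filter) =
     (INF e\<in>{0<..}. principal {(p, q). dist p q < e})"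

definition open_riemann_sphere_def:
  "open (U :: riemann_sphere set) \<longleftrightarrow>
     (\<forall>p\<in>U. \<forall>\<^sub>F (p', q) in uniformity. p' = p \<longrightarrow> q \<in> U)"

instance
proof
  fix p q r :: riemann_sphere
  have le1: "\<bar>stereographic p \<bullet> stereographic q\<bar> \<le> 1"
    using Cauchy_Schwarz_ineq2[of "stereographic p" "stereographic q"] by simp
  then have "dist p q = 0 \<longleftrightarrow> stereographic p \<bullet> stereographic q = 1"
    by (simp add: dist_riemann_sphere_def arccos_eq_0_iff abs_le_iff)
  also have "\<dots> \<longleftrightarrow> stereographic p = stereographic q"
  proof
    assume 1: "stereographic p \<bullet> stereographic q = 1"
    have "(norm (stereographic p - stereographic q))\<^sup>2 =
        (norm (stereographic p))\<^sup>2 + (norm (stereographic q))\<^sup>2 - 2 * (stereographic p \<bullet> stereographic q)"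
      unfolding power2_norm_eq_inner by (simp add: inner_diff inner_commute)
    with 1 show "stereographic p = stereographic q" by simp
  qed (simp add: dot_square_norm)
  finally show "dist p q = 0 \<longleftrightarrow> p = q"
    by (simp add: stereographic_eq_iff)
  show "dist p q \<le> dist p r + dist q r"
    using arccos_inner_triangle[of "stereographic p" "stereographic r" "stereographic q"]
    by (simp add: dist_riemann_sphere_def inner_commute)
qed (simp_all only: uniformity_riemann_sphere_def open_riemann_sphere_def)

end

text \<open>A meromorphic function is represented by a function satisfying
  \<^const>\<open>nicely_meromorphic_on\<close>, so it is continuous off its poles, but its
  value at a pole is the junk value \<^term>\<open>0 :: complex\<close>.\<close>

definition sphere_value :: "(complex \<Rightarrow> complex) \<Rightarrow> complex \<Rightarrow> riemann_sphere" where
  "sphere_value f z = (if is_pole f z then Infinity else Finite (f z))"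

definition locally_uniform_limit ::
    "complex set \<Rightarrow> (nat \<Rightarrow> complex \<Rightarrow> riemann_sphere) \<Rightarrow> (complex \<Rightarrow> riemann_sphere) \<Rightarrow> bool" where
  "locally_uniform_limit U h g \<longleftrightarrow>
     (\<forall>z\<in>U. \<exists>r>0. ball z r \<subseteq> U \<and> uniform_limit (ball z r) h g sequentially)"

definition normal_family_on :: "(complex \<Rightarrow> complex) set \<Rightarrow> complex set \<Rightarrow> bool" where
  "normal_family_on F U \<longleftrightarrow>
     (\<forall>s :: nat \<Rightarrow> complex \<Rightarrow> complex. (\<forall>n. s n \<in> F) \<longrightarrow>
        (\<exists>k g. strict_mono k \<and> locally_uniform_limit U (\<lambda>n. sphere_value (s (k n))) g))"

definition normal_family_at :: "(complex \<Rightarrow> complex) set \<Rightarrow> complex set \<Rightarrow> complex \<Rightarrow> bool" where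
  "normal_family_at F D z0 \<longleftrightarrow> (\<exists>r>0. ball z0 r \<subseteq> D \<and> normal_family_on F (ball z0 r))"

text \<open>The limit at a pole always exists in \<^typ>\<open>ennreal\<close> if \<open>f\<close> is meromorphic:
  for a pole of order \<open>m\<close> the quotient behaves like a positive constant times
  \<open>r powr (m * \<alpha> - m - 1)\<close> at distance \<open>r\<close> from the pole, when \<open>\<alpha> > 0\<close>.\<close>

definition deriv_quotient :: "real \<Rightarrow> (complex \<Rightarrow> complex) \<Rightarrow> complex \<Rightarrow> ennreal" where
  "deriv_quotient \<alpha> f z =
     (let q = (\<lambda>w. ennreal (norm (deriv f w) / (1 + norm (f w) powr \<alpha>)))
      in if is_pole f z then Lim (at z) q else q z)"

end

theory Submission
  imports Defs
begin

text \<open>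
  As \<open>\<alpha> \<ge> 1\<close>, the hypothesis gives \<open>1 + |f| \<le> B |f'|\<close> off the poles, so that \<open>h = f / f'\<close> and
  \<open>g = 1 / f'\<close> extend to holomorphic functions bounded by \<open>B\<close>, and \<open>f g' = h' - 1\<close>.  At a pole of
  order \<open>m\<close> the derivative of \<open>h\<close> is \<open>-1 / m\<close>.  Since the poles \<open>p\<^sub>n\<close> tend to \<open>z\<^sub>0\<close>, Cauchy's estimate
  for \<open>h''\<close> keeps \<open>h' - 1\<close> away from \<open>0\<close> on a fixed disc around \<open>z\<^sub>0\<close>, and there \<open>1 / f = g' / (h' - 1)\<close>
  is bounded independently of \<open>n\<close>.  Now Montel's theorem applies to the functions \<open>1 / f\<^sub>n\<close>.
\<close>

section \<open>The functions \<open>f / f'\<close> and \<open>1 / f'\<close> and their behaviour at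
  the poles of \<open>f\<close>\<close>

text \<open>The value \<open>0\<close> at a pole is the continuous extension: at a pole of order
  \<open>m\<close>, \<open>f / f'\<close> has a simple zero and \<open>1 / f'\<close> a zero of
  order \<open>m + 1\<close>.\<close>

definition newton_quotient :: "(complex \<Rightarrow> complex) \<Rightarrow> complex \<Rightarrow> complex" where
  "newton_quotient f z = (if is_pole f z then 0 else f z / deriv f z)"

definition recip_deriv :: "(complex \<Rightarrow> complex) \<Rightarrow> complex \<Rightarrow> complex" where
  "recip_deriv f z = (if is_pole f z then 0 else 1 / deriv f z)"

text \<open>Reciprocal as a map into the sphere. The case \<open>u = 0\<close> is separate because
  \<open>1 / 0 = 0\<close> for complex numbers, whereas a pole has to go to
  \<open>Infinity\<close>.\<close>

definition sphere_inverse :: "complex \<Rightarrow> riemann_sphere" where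
  "sphere_inverse u = (if u = 0 then Infinity else Finite (1 / u))"

text \<open>Serves to extend a quotient over a pole: once a factor \<open>z - p\<close> is split
  off, the product rule at \<open>p\<close> leaves only \<open>k p\<close>.\<close>

lemma deriv_linear_factor:
  fixes k :: "complex \<Rightarrow> complex"
  assumes "open S" "p \<in> S" "k holomorphic_on S" "\<And>z. z \<in> S \<Longrightarrow> h z = (z - p) * k z"
  shows "h holomorphic_on S" "deriv h p = k p"
proof -
  have "(\<lambda>z. (z - p) * k z) holomorphic_on S"
    using assms(3) by (intro holomorphic_intros)
  then show "h holomorphic_on S"
    using holomorphic_cong[OF refl assms(4)] by simp
  have "(k has_field_derivative deriv k p) (at p)"
    using assms holomorphic_derivI by blast
  then have "((\<lambda>z. (z - p) * k z) has_field_derivative k p) (at p)"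
    by (auto intro!: derivative_eq_intros)
  then have "(h has_field_derivative k p) (at p)"
    by (rule has_field_derivative_transform_within_open[OF _ assms(1,2)]) (simp add: assms(4))
  then show "deriv h p = k p"
    by (rule DERIV_imp_deriv)
qed

text \<open>Write \<open>f = w / (z - p) ^ m\<close> with \<open>w p \<noteq> 0\<close>. Then
  \<open>f' = E / (z - p) ^ Suc m\<close>, so \<open>f / f' = (z - p) * (w / E)\<close> and
  \<open>1 / f' = (z - p) * ((z - p) ^ m / E)\<close>. Since \<open>E p = - m * w p\<close>, the
  derivatives at \<open>p\<close> are \<open>- 1 / m\<close> and, because \<open>m > 0\<close>,
  zero.\<close>

lemma quotients_at_pole:
  fixes f :: "complex \<Rightarrow> complex"
  assumes "open S" "p \<in> S" "f holomorphic_on S - {p}" "is_pole f p"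
    and nz: "\<And>z. z \<in> S - {p} \<Longrightarrow> deriv f z \<noteq> 0"
  obtains r where "r > 0" "newton_quotient f holomorphic_on ball p r"
    "recip_deriv f holomorphic_on ball p r"
    "Re (deriv (newton_quotient f) p) \<le> 0" "deriv (recip_deriv f) p = 0"
proof -
  define m where "m = nat (- zorder f p)"
  define w where "w = zor_poly f p"
  obtain r where m: "m > 0" and r: "r > 0" "cball p r \<subseteq> S" "w holomorphic_on cball p r" and wp: "w p \<noteq> 0"
    and fw: "\<And>z. z \<in> cball p r - {p} \<Longrightarrow> f z = w z / (z - p) ^ m"
    using zorder_exist_pole[OF assms(3,1,2,4)] unfolding m_def w_def by auto
  \<comment> \<open>The numerator of \<open>f'\<close> by the quotient rule, after cancelling
    \<open>(z - p) ^ (m - 1)\<close>.\<close>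
  define E where "E = (\<lambda>z. (z - p) * deriv w z - of_nat m * w z)"
  have wh: "w holomorphic_on ball p r"
    using r(3) by (rule holomorphic_on_subset) auto
  have Eh: "E holomorphic_on ball p r"
    unfolding E_def using wh by (intro holomorphic_intros) auto
  have Ep: "E p = - of_nat m * w p"
    by (simp add: E_def)
  have df: "deriv f z = E z / (z - p) ^ Suc m" if z: "z \<in> ball p r - {p}" for z
  proof -
    have "(w has_field_derivative deriv w z) (at z)"
      using wh z holomorphic_derivI by blast
    then have "((\<lambda>z. w z / (z - p) ^ m) has_field_derivative
        ((deriv w z * (z - p) ^ m - w z * (of_nat m * (z - p) ^ (m - 1))) / ((z - p) ^ m * (z - p) ^ m))) (at z)"
      using z by (auto intro!: derivative_eq_intros)
    also have "(deriv w z * (z - p) ^ m - w z * (of_nat m * (z - p) ^ (m - 1))) / ((z - p) ^ m * (z - p) ^ m)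
        = E z / (z - p) ^ Suc m"
    proof -
      \<comment> \<open>Writing \<open>m = Suc k\<close> removes the truncated subtraction in
        \<open>m - 1\<close>; abstracting \<open>d\<close> and \<open>P\<close> leaves a plain field
        identity.\<close>
      obtain k where k: "m = Suc k" using m by (cases m) auto
      define d P where "d = z - p" and "P = (z - p) ^ k"
      have "d \<noteq> 0" "P \<noteq> 0" using z by (auto simp: d_def P_def)
      then have "(deriv w z * (d * P) - w z * (of_nat m * P)) / ((d * P) * (d * P))
          = (d * deriv w z - of_nat m * w z) / (d * (d * P))"
        by (simp add: divide_simps) (simp add: algebra_simps)
      then show ?thesis by (simp add: E_def k d_def P_def)
    qed
    finally have "(f has_field_derivative E z / (z - p) ^ Suc m) (at z)"
      by (rule has_field_derivative_transform_within_open[of _ _ _ "ball p r - {p}"]) (use z fw in auto)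
    then show ?thesis by (rule DERIV_imp_deriv)
  qed
  have np: "\<not> is_pole f z" if "z \<in> ball p r - {p}" for z
  proof -
    have "z \<in> S - {p}" using that r(2) by auto
    then have "f analytic_on {z}"
      using assms(1,3) by (meson analytic_at open_Diff closed_singleton)
    then show ?thesis by (rule analytic_at_imp_no_pole)
  qed
  \<comment> \<open>At \<open>p\<close> this is \<open>m * w p \<noteq> 0\<close>; elsewhere a zero
    of \<open>E\<close> would be a zero of \<open>f'\<close>.\<close>
  have E0: "E z \<noteq> 0" if "z \<in> ball p r" for z
  proof (cases "z = p")
    case True then show ?thesis using Ep wp m by simp
  next
    case False
    then have "z \<in> S - {p}" "z \<in> ball p r - {p}" using that r(2) by auto
    then show ?thesis using nz df by fastforce
  qed
  have h: "newton_quotient f z = (z - p) * (w z / E z)" if "z \<in> ball p r" for z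
  proof (cases "z = p")
    case False
    with that have z: "z \<in> ball p r - {p}" "z \<in> cball p r - {p}" by auto
    then show ?thesis
      using np[OF z(1)] fw[OF z(2)] df[OF z(1)] False E0[OF that] by (simp add: newton_quotient_def)
  qed (simp add: newton_quotient_def assms(4))
  have g: "recip_deriv f z = (z - p) * ((z - p) ^ m / E z)" if "z \<in> ball p r" for z
  proof (cases "z = p")
    case False
    with that have z: "z \<in> ball p r - {p}" by auto
    then show ?thesis
      using np[OF z] df[OF z] False E0[OF that] by (simp add: recip_deriv_def)
  qed (simp add: recip_deriv_def assms(4))
  have "(\<lambda>z. w z / E z) holomorphic_on ball p r" "(\<lambda>z. (z - p) ^ m / E z) holomorphic_on ball p r"
    using wh Eh E0 by (auto intro!: holomorphic_intros)
  note hol = deriv_linear_factor[OF open_ball _ this(1) h] deriv_linear_factor[OF open_ball _ this(2) g]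
  have "deriv (newton_quotient f) p = - (1 / of_nat m)"
    using hol(2) r(1) wp m by (simp add: Ep)
  moreover have "- (1 / of_nat m) = complex_of_real (- (1 / real m))"
    by simp
  ultimately have "Re (deriv (newton_quotient f) p) = - (1 / real m)"
    by (metis Re_complex_of_real)
  moreover have "deriv (recip_deriv f) p = 0"
    using hol(4) r(1) m by simp
  ultimately show thesis
    using hol(1,3) r(1) that by force
qed

text \<open>Holomorphy is local. Poles are isolated, so the preceding analysis applies near each of
  them; at all other points \<open>f\<close> is analytic. The last identity is the product rule for
  \<open>h = f * g\<close> with \<open>g = 1 / f'\<close>:
  \<open>h' = f' * g + f * g' = 1 + f * g'\<close>.\<close>

lemma quotients_holomorphic:
  assumes "f nicely_meromorphic_on S" "open S"
    and nz: "\<forall>z\<in>S. \<not> is_pole f z \<longrightarrow> deriv f z \<noteq> 0"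
  shows "newton_quotient f holomorphic_on S" "recip_deriv f holomorphic_on S"
    and "\<And>z. z \<in> S \<Longrightarrow> is_pole f z \<Longrightarrow> Re (deriv (newton_quotient f) z) \<le> 0"
    and "\<And>z. z \<in> S \<Longrightarrow> is_pole f z \<Longrightarrow> deriv (recip_deriv f) z = 0"
    and "\<And>z. z \<in> S \<Longrightarrow> \<not> is_pole f z \<Longrightarrow> f z * deriv (recip_deriv f) z = deriv (newton_quotient f) z - 1"
proof -
  have pole: "newton_quotient f analytic_on {p} \<and> recip_deriv f analytic_on {p} \<and>
      Re (deriv (newton_quotient f) p) \<le> 0 \<and> deriv (recip_deriv f) p = 0"
    if p: "p \<in> S" "is_pole f p" for p
  proof -
    have "f meromorphic_on {p}"
      using assms(1) p(1) meromorphic_on_subset unfolding nicely_meromorphic_on_def by blast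
    then have "isolated_singularity_at f p"
      by (simp add: meromorphic_at_iff)
    \<comment> \<open>In a disc where \<open>p\<close> is the only singularity, all other points are
      regular, so \<open>nz\<close> yields \<open>f' \<noteq> 0\<close> there.\<close>
    then obtain r where r: "r > 0" "f analytic_on ball p r - {p}"
      unfolding isolated_singularity_at_def by blast
    have "deriv f z \<noteq> 0" if "z \<in> (S \<inter> ball p r) - {p}" for z
    proof -
      have "f analytic_on {z}"
        using r(2) that by (auto intro: analytic_on_subset)
      then show ?thesis using nz analytic_at_imp_no_pole that by blast
    qed
    moreover have "f holomorphic_on (S \<inter> ball p r) - {p}"
      by (rule holomorphic_on_subset[OF analytic_imp_holomorphic[OF r(2)]]) auto
    ultimately obtain s where s: "s > 0" "newton_quotient f holomorphic_on ball p s"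
        "recip_deriv f holomorphic_on ball p s"
        "Re (deriv (newton_quotient f) p) \<le> 0" "deriv (recip_deriv f) p = 0"
      using quotients_at_pole[of "S \<inter> ball p r" p f] p assms(2) r(1) by (auto simp: open_Int)
    then show ?thesis
      using analytic_at open_ball centre_in_ball by blast
  qed
  have regular: "newton_quotient f analytic_on {z} \<and> recip_deriv f analytic_on {z} \<and>
      f z * deriv (recip_deriv f) z = deriv (newton_quotient f) z - 1"
    if z: "z \<in> S" "\<not> is_pole f z" for z
  proof -
    \<comment> \<open>Nice meromorphy enters here: a point that is not a pole is not a removable
      singularity with a wrong value either.\<close>
    have "f analytic_on {z}"
      using assms(1) z by (rule nicely_meromorphic_on_imp_analytic_at)
    then obtain T where T: "open T" "z \<in> T" "f holomorphic_on T"
      unfolding analytic_at by blast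
    define U where "U = S \<inter> T"
    have U: "open U" "z \<in> U" "f holomorphic_on U"
      using T z assms(2) by (auto simp: U_def intro: holomorphic_on_subset)
    have np: "\<not> is_pole f x" if "x \<in> U" for x
      using U that analytic_at_imp_no_pole analytic_at by blast
    have nz': "deriv f x \<noteq> 0" if "x \<in> U" for x
      using np[OF that] nz that by (auto simp: U_def)
    have g: "recip_deriv f x = 1 / deriv f x" and h: "newton_quotient f x = f x * recip_deriv f x"
      if "x \<in> U" for x
      using np[OF that] by (auto simp: recip_deriv_def newton_quotient_def)
    have "(\<lambda>x. 1 / deriv f x) holomorphic_on U"
      using U nz' by (intro holomorphic_intros) auto
    then have gh: "recip_deriv f holomorphic_on U"
      using holomorphic_cong[OF refl g] by simp
    have "(\<lambda>x. f x * recip_deriv f x) holomorphic_on U"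
      using U gh by (intro holomorphic_intros)
    then have hh: "newton_quotient f holomorphic_on U"
      using holomorphic_cong[OF refl h] by simp
    have "((\<lambda>x. f x * recip_deriv f x) has_field_derivative
        (deriv f z * recip_deriv f z + deriv (recip_deriv f) z * f z)) (at z)"
      using U gh by (intro DERIV_mult holomorphic_derivI)
    then have "(newton_quotient f has_field_derivative
        (deriv f z * recip_deriv f z + deriv (recip_deriv f) z * f z)) (at z)"
      by (rule has_field_derivative_transform_within_open[OF _ U(1,2)]) (simp add: h)
    then have "deriv (newton_quotient f) z = 1 + f z * deriv (recip_deriv f) z"
      using g nz' U(2) by (simp add: DERIV_imp_deriv mult.commute)
    then show ?thesis
      using U gh hh analytic_at by auto
  qed
  have "newton_quotient f analytic_on S" "recip_deriv f analytic_on S"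
    using pole regular by (metis analytic_on_analytic_at)+
  then show "newton_quotient f holomorphic_on S" "recip_deriv f holomorphic_on S"
    by (simp_all add: analytic_imp_holomorphic)
  show "Re (deriv (newton_quotient f) z) \<le> 0" "deriv (recip_deriv f) z = 0"
    if "z \<in> S" "is_pole f z" for z
    using pole[OF that] by auto
  show "f z * deriv (recip_deriv f) z = deriv (newton_quotient f) z - 1"
    if "z \<in> S" "\<not> is_pole f z" for z
    using regular[OF that] by auto
qed

section \<open>Cauchy estimates and a uniform bound for \<open>1 / f\<close>\<close>

text \<open>Cauchy's inequality on the circle of radius \<open>R\<close> about \<open>z\<close>,
  which stays inside \<open>ball a (2 * R)\<close>.\<close>

lemma deriv_bounds:
  fixes h :: "complex \<Rightarrow> complex"
  assumes "h holomorphic_on ball a (2 * R)" "R > 0" "\<And>z. z \<in> ball a (2 * R) \<Longrightarrow> norm (h z) \<le> B"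
    and z: "z \<in> ball a R"
  shows "norm (deriv h z) \<le> B / R" "norm (deriv (deriv h) z) \<le> 2 * B / R\<^sup>2"
proof -
  have sub: "cball z R \<subseteq> ball a (2 * R)"
    using z by (simp add: cball_subset_ball_iff dist_commute)
  have "norm ((deriv ^^ n) h z) \<le> fact n * B / R ^ n" for n
  proof (rule Cauchy_inequality)
    show "h holomorphic_on ball z R"
      using assms(1) sub ball_subset_cball by (meson holomorphic_on_subset order_trans)
    show "continuous_on (cball z R) h"
      using assms(1) sub by (meson holomorphic_on_subset holomorphic_on_imp_continuous_on)
    show "norm (h x) \<le> B" if "norm (z - x) = R" for x
      using assms(3) sub that by (metis dist_norm mem_cball order_refl subsetD)
  qed (use assms in auto)
  from this[of 1] this[of 2] show "norm (deriv h z) \<le> B / R" "norm (deriv (deriv h) z) \<le> 2 * B / R\<^sup>2"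
    by (simp_all add: numeral_2_eq_2)
qed

text \<open>The condition \<open>8 * B * r \<le> R\<^sup>2\<close> is chosen so that
  \<open>h'\<close> varies by at most \<open>1 / 2\<close> on \<open>ball a r\<close>: there
  \<open>|h''| \<le> 2 * B / R\<^sup>2\<close>, and \<open>p\<close> is within \<open>2 * r\<close>
  of every point. The bound on \<open>u\<close> is \<open>B / R\<close>, from Cauchy's estimate for
  \<open>g'\<close>, divided by \<open>1 / 2\<close>.\<close>

lemma reciprocal_bounded_near_pole:
  assumes f: "f nicely_meromorphic_on ball a (2 * R)" and R: "R > 0"
    and bound: "\<And>z. z \<in> ball a (2 * R) \<Longrightarrow> \<not> is_pole f z \<Longrightarrow> 1 + norm (f z) \<le> B * norm (deriv f z)"
    and "B > 0" and r: "r \<le> R" "8 * B * r \<le> R\<^sup>2"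
    and p: "p \<in> ball a r" "is_pole f p"
  shows "\<exists>u. u holomorphic_on ball a r \<and>
    (\<forall>z\<in>ball a r. norm (u z) \<le> 2 * B / R \<and> sphere_value f z = sphere_inverse (u z))"
proof -
  define g h where "g = recip_deriv f" and "h = newton_quotient f"
  have nz: "deriv f z \<noteq> 0" if "z \<in> ball a (2 * R)" "\<not> is_pole f z" for z
  proof
    assume "deriv f z = 0"
    then have "1 + norm (f z) \<le> 0" using bound[OF that] by simp
    then show False using norm_ge_zero[of "f z"] by linarith
  qed
  then have nz': "\<forall>z\<in>ball a (2 * R). \<not> is_pole f z \<longrightarrow> deriv f z \<noteq> 0"
    by blast
  note q = quotients_holomorphic[OF f open_ball nz', folded g_def h_def]
  \<comment> \<open>Off the poles both \<open>1\<close> and \<open>|f|\<close> are at most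
    \<open>B * |f'|\<close>; at the poles both functions are \<open>0\<close>.\<close>
  have gB: "norm (g z) \<le> B" and hB: "norm (h z) \<le> B" if z: "z \<in> ball a (2 * R)" for z
  proof -
    have "norm (g z) \<le> B \<and> norm (h z) \<le> B"
    proof (cases "is_pole f z")
      case True then show ?thesis using \<open>B > 0\<close> by (simp add: g_def h_def recip_deriv_def newton_quotient_def)
    next
      case False
      have "norm (deriv f z) > 0" "1 \<le> B * norm (deriv f z)" "norm (f z) \<le> B * norm (deriv f z)"
        using nz[OF z False] bound[OF z False] norm_ge_zero[of "f z"] by (simp, linarith+)
      then show ?thesis
        using False by (simp add: g_def h_def recip_deriv_def newton_quotient_def norm_divide divide_simps)
    qed
    then show "norm (g z) \<le> B" "norm (h z) \<le> B" by auto
  qed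
  have sub: "ball a r \<subseteq> ball a R" "ball a R \<subseteq> ball a (2 * R)"
    using r R by auto
  then have pin: "p \<in> ball a (2 * R)"
    using p by blast
  have lip: "norm (deriv h z - deriv h p) \<le> 1 / 2" if z: "z \<in> ball a r" for z
  proof -
    have "deriv h holomorphic_on ball a (2 * R)"
      using q(1) by (intro holomorphic_intros) auto
    then have "(deriv h has_field_derivative deriv (deriv h) x) (at x within ball a r)"
      if "x \<in> ball a r" for x
      using that sub by (meson holomorphic_derivI has_field_derivative_at_within open_ball subsetD)
    then have "norm (deriv h z - deriv h p) \<le> 2 * B / R\<^sup>2 * norm (z - p)"
      using deriv_bounds(2)[OF q(1) R hB] sub p z by (intro field_differentiable_bound[of "ball a r"]) auto
    also have "norm (z - p) \<le> 2 * r"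
      using dist_triangle[of z p a] z p by (simp add: dist_norm norm_minus_commute)
    then have "2 * B / R\<^sup>2 * norm (z - p) \<le> 2 * B / R\<^sup>2 * (2 * r)"
      using \<open>B > 0\<close> by (intro mult_left_mono) auto
    also have "\<dots> \<le> 1 / 2"
      using r(2) R by (simp add: divide_simps)
    finally show ?thesis .
  qed
  \<comment> \<open>\<open>Re (h' p) \<le> 0\<close> and the variation of at most
    \<open>1 / 2\<close> keep \<open>Re h'\<close> at most \<open>1 / 2\<close>, hence at distance
    at least \<open>1 / 2\<close> from \<open>1\<close>.\<close>
  have away: "norm (deriv h z - 1) \<ge> 1 / 2" if z: "z \<in> ball a r" for z
  proof -
    have "Re (deriv h z) \<le> 1 / 2"
      using q(3)[OF pin p(2)] lip[OF z] abs_Re_le_cmod[of "deriv h z - deriv h p"] by simp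
    then show ?thesis
      using abs_Re_le_cmod[of "deriv h z - 1"] by simp
  qed
  \<comment> \<open>The holomorphic form of \<open>1 / f\<close>: off the poles
    \<open>f * g' = h' - 1\<close>, and at a pole \<open>g' = 0\<close> gives \<open>u = 0\<close>,
    which represents \<open>Infinity\<close>.\<close>
  define u where "u = (\<lambda>z. deriv g z / (deriv h z - 1))"
  have "u holomorphic_on ball a r"
    unfolding u_def
  proof (intro holomorphic_intros)
    show "g holomorphic_on ball a r" "h holomorphic_on ball a r"
      using q(1,2) sub by (meson holomorphic_on_subset order_trans)+
    show "deriv h z - 1 \<noteq> 0" if "z \<in> ball a r" for z
      using away[OF that] by auto
  qed auto
  moreover have "norm (u z) \<le> 2 * B / R" if z: "z \<in> ball a r" for z
  proof -
    have "norm (deriv g z) \<le> B / R"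
      using deriv_bounds(1)[OF q(2) R gB] sub z by blast
    then have "norm (deriv g z) / norm (deriv h z - 1) \<le> (B / R) / (1 / 2)"
      using away[OF z] \<open>B > 0\<close> R by (intro frac_le) auto
    then show ?thesis by (simp add: u_def norm_divide mult.commute)
  qed
  moreover have "sphere_value f z = sphere_inverse (u z)" if z: "z \<in> ball a r" for z
  proof (cases "is_pole f z")
    case True
    moreover have "deriv g z = 0"
      using q(4) sub z True by blast
    ultimately show ?thesis
      by (simp add: sphere_value_def sphere_inverse_def u_def)
  next
    case False
    then have "f z * deriv g z = deriv h z - 1"
      using q(5) sub z by blast
    \<comment> \<open>As the product \<open>f z * g' z\<close> is nonzero, so is \<open>f z\<close>;
      thus \<open>f\<close> has no zeros in this disc and the reciprocal is a genuine one.\<close>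
    moreover have "deriv h z - 1 \<noteq> 0"
      using away[OF z] by auto
    ultimately have "u z \<noteq> 0" "f z = 1 / u z"
      by (auto simp: u_def divide_simps)
    with False show ?thesis by (simp add: sphere_value_def sphere_inverse_def)
  qed
  ultimately show ?thesis by blast
qed

section \<open>Continuity of the reciprocal into the sphere\<close>

text \<open>Inversion acts on the unit sphere as the half turn about the real axis: it conjugates
  the first component and negates the height. The resulting formula also covers
  \<open>u = 0\<close>, so continuity there needs no separate argument.\<close>

lemma stereographic_sphere_inverse:
  "stereographic (sphere_inverse u) =
    ((2 / (1 + (norm u)\<^sup>2)) *\<^sub>R cnj u, (1 - (norm u)\<^sup>2) / (1 + (norm u)\<^sup>2))"
proof (cases "u = 0")
  case False
  have 1: "1 + (norm u)\<^sup>2 > 0"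
    by (simp add: add_pos_nonneg)
  have "1 / u = (1 / (norm u)\<^sup>2) *\<^sub>R cnj u"
    using complex_div_cnj[of 1 u] by (simp add: scaleR_conv_of_real)
  then have "(2 / (1 + (norm (1 / u))\<^sup>2)) *\<^sub>R (1 / u)
      = (2 / (1 + (norm (1 / u))\<^sup>2) * (1 / (norm u)\<^sup>2)) *\<^sub>R cnj u"
    by simp
  also have "2 / (1 + (norm (1 / u))\<^sup>2) * (1 / (norm u)\<^sup>2) = 2 / (1 + (norm u)\<^sup>2)"
    using False 1 by (simp add: norm_divide power_divide divide_simps add.commute)
  finally have "(2 / (1 + (norm (1 / u))\<^sup>2)) *\<^sub>R (1 / u) = (2 / (1 + (norm u)\<^sup>2)) *\<^sub>R cnj u" .
  moreover have "((norm (1 / u))\<^sup>2 - 1) / ((norm (1 / u))\<^sup>2 + 1) = (1 - (norm u)\<^sup>2) / (1 + (norm u)\<^sup>2)"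
    using False 1 by (simp add: norm_divide power_divide divide_simps)
  ultimately show ?thesis
    using False by (simp add: sphere_inverse_def)
qed (simp add: sphere_inverse_def)

text \<open>The distance is the \<open>arccos\<close> of an inner product of unit vectors; by
  continuity of \<open>F\<close> this product tends to \<open>1\<close>, and
  \<open>arccos 1 = 0\<close>.\<close>

lemma continuous_on_sphere_inverse: "continuous_on UNIV sphere_inverse"
proof (rule continuous_at_imp_continuous_on, intro ballI)
  fix u :: complex
  define F where "F = (\<lambda>v. stereographic (sphere_inverse v))"
  have pos: "1 + (norm v)\<^sup>2 \<noteq> 0" for v :: complex
    by (metis add_pos_nonneg less_irrefl zero_le_power2 zero_less_one)
  have "isCont F u"
    unfolding F_def stereographic_sphere_inverse using pos by (intro continuous_intros) auto
  then have "((\<lambda>v. F v \<bullet> F u) \<longlongrightarrow> F u \<bullet> F u) (at u)"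
    by (intro tendsto_intros isContD)
  moreover have "F u \<bullet> F u = 1"
    by (simp add: F_def dot_square_norm)
  \<comment> \<open>Keeps the argument inside \<open>{-1..1}\<close>, the set on which
    \<open>arccos\<close> is continuous.\<close>
  moreover have "F v \<bullet> F u \<in> {-1..1}" for v
    using Cauchy_Schwarz_ineq2[of "F v" "F u"] by (simp add: F_def abs_le_iff)
  ultimately have "((\<lambda>v. arccos (F v \<bullet> F u)) \<longlongrightarrow> arccos 1) (at u)"
    by (intro continuous_on_tendsto_compose[OF continuous_on_arccos']) auto
  then have "((\<lambda>v. dist (sphere_inverse v) (sphere_inverse u)) \<longlongrightarrow> 0) (at u)"
    by (simp add: F_def dist_riemann_sphere_def)
  then show "isCont sphere_inverse u"
    unfolding isCont_def by (rule tendsto_dist_iff[THEN iffD2])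
qed

section \<open>Normality: Montel's theorem, finite families and unions\<close>

text \<open>Montel gives a subsequence of the \<open>u n\<close> converging uniformly on compact
  sets. All values lie in the compact disc \<open>cball 0 M\<close>, where
  \<open>sphere_inverse\<close> is uniformly continuous, so uniform convergence passes to the
  sphere. Zeros of the limit \<open>g\<close> become the value \<open>Infinity\<close>.\<close>

lemma normal_family_on_bounded_reciprocals:
  assumes U: "open U"
    and recip: "\<And>F. F \<in> \<F> \<Longrightarrow> \<exists>u. u holomorphic_on U \<and>
      (\<forall>z\<in>U. norm (u z) \<le> M \<and> sphere_value F z = sphere_inverse (u z))"
  shows "normal_family_on \<F> U"
  unfolding normal_family_on_def
proof (intro allI impI)
  fix s :: "nat \<Rightarrow> complex \<Rightarrow> complex" assume s: "\<forall>n. s n \<in> \<F>"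
  then have "\<forall>n. \<exists>u. u holomorphic_on U \<and>
      (\<forall>z\<in>U. norm (u z) \<le> M \<and> sphere_value (s n) z = sphere_inverse (u z))"
    using recip by blast
  from choice[OF this] obtain u where "\<forall>n. u n holomorphic_on U \<and>
      (\<forall>z\<in>U. norm (u n z) \<le> M \<and> sphere_value (s n) z = sphere_inverse (u n z))"
    by blast
  then have hol: "\<And>n. u n holomorphic_on U"
    and bd: "\<And>n z. z \<in> U \<Longrightarrow> norm (u n z) \<le> M"
    and eq: "\<And>n z. z \<in> U \<Longrightarrow> sphere_value (s n) z = sphere_inverse (u n z)"
    by blast+
  obtain g k where k: "strict_mono (k :: nat \<Rightarrow> nat)"
    and lim: "\<And>K. \<lbrakk>compact K; K \<subseteq> U\<rbrakk> \<Longrightarrow> uniform_limit K (u \<circ> k) g sequentially"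
    by (rule Montel[of U "range u" u]) (use U hol bd in \<open>auto, blast\<close>)
  have unif: "uniformly_continuous_on (cball 0 M) sphere_inverse"
    using continuous_on_sphere_inverse continuous_on_subset
    by (intro compact_uniformly_continuous) auto
  have "\<exists>r>0. ball z r \<subseteq> U \<and>
      uniform_limit (ball z r) (\<lambda>n. sphere_value (s (k n))) (\<lambda>x. sphere_inverse (g x)) sequentially"
    if "z \<in> U" for z
  proof -
    obtain r where r: "r > 0" "cball z r \<subseteq> U"
      using U \<open>z \<in> U\<close> open_contains_cball by blast
    then have sub: "ball z r \<subseteq> U" by auto
    have "uniform_limit (ball z r) (u \<circ> k) g sequentially"
      using lim[OF compact_cball r(2)] by (rule uniform_limit_on_subset) auto
    then have "uniform_limit (ball z r) (\<lambda>n x. sphere_inverse ((u \<circ> k) n x)) (\<lambda>x. sphere_inverse (g x)) sequentially"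
      by (rule uniform_limit_compose_uniformly_continuous_on[OF _ unif])
        (use bd sub in \<open>auto intro!: always_eventually\<close>)
    also have "?this \<longleftrightarrow>
        uniform_limit (ball z r) (\<lambda>n. sphere_value (s (k n))) (\<lambda>x. sphere_inverse (g x)) sequentially"
      by (rule uniform_limit_cong') (use eq sub in auto)
    finally show ?thesis using r sub by blast
  qed
  then show "\<exists>k g. strict_mono k \<and> locally_uniform_limit U (\<lambda>n. sphere_value (s (k n))) g"
    using k unfolding locally_uniform_limit_def by blast
qed

lemma infinite_Collect_subseq:
  assumes "infinite {n :: nat. P n}"
  obtains e :: "nat \<Rightarrow> nat" where "strict_mono e" "\<And>n. P (e n)"
  using strict_mono_enumerate[OF assms] enumerate_in_set[OF assms] that by blast

text \<open>By pigeonhole some member recurs infinitely often, giving a constant subsequence. This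
  handles the finitely many functions whose chosen pole may still be far from
  \<open>z0\<close>.\<close>

lemma normal_family_on_finite:
  assumes "finite \<F>" "open U"
  shows "normal_family_on \<F> U"
  unfolding normal_family_on_def
proof (intro allI impI)
  fix s :: "nat \<Rightarrow> complex \<Rightarrow> complex" assume "\<forall>n. s n \<in> \<F>"
  then have "finite (range s)"
    using assms(1) by (meson finite_subset image_subsetI)
  then obtain n0 where "infinite {n. s n = s n0}"
    using pigeonhole_infinite[of UNIV s] by auto
  then obtain e :: "nat \<Rightarrow> nat" where e: "strict_mono e" "\<And>n. s (e n) = s n0"
    using infinite_Collect_subseq[of "\<lambda>n. s n = s n0"] by blast
  have "locally_uniform_limit U (\<lambda>n. sphere_value (s (e n))) (sphere_value (s n0))"
    unfolding locally_uniform_limit_def e(2)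
    using assms(2) open_contains_ball uniform_limit_const by blast
  with e(1) show "\<exists>k g. strict_mono k \<and> locally_uniform_limit U (\<lambda>n. sphere_value (s (k n))) g"
    by blast
qed

text \<open>One of the two families contains infinitely many terms of the sequence; a subsequence of
  that part is a subsequence of the whole.\<close>

lemma normal_family_on_Un:
  assumes "normal_family_on \<F> U" "normal_family_on \<G> U"
  shows "normal_family_on (\<F> \<union> \<G>) U"
  unfolding normal_family_on_def
proof (intro allI impI)
  fix s :: "nat \<Rightarrow> complex \<Rightarrow> complex" assume "\<forall>n. s n \<in> \<F> \<union> \<G>"
  then have "{n. s n \<in> \<F>} \<union> {n. s n \<in> \<G>} = UNIV"
    by auto
  then have "infinite {n. s n \<in> \<F>} \<or> infinite {n. s n \<in> \<G>}"
    using infinite_UNIV_nat finite_Un by metis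
  then obtain \<H> where "infinite {n. s n \<in> \<H>}" and "normal_family_on \<H> U"
    using assms by blast
  moreover from this(1) obtain e :: "nat \<Rightarrow> nat" where e: "strict_mono e" "\<And>n. s (e n) \<in> \<H>"
    using infinite_Collect_subseq[of "\<lambda>n. s n \<in> \<H>"] by blast
  ultimately obtain k g where "strict_mono k" "locally_uniform_limit U (\<lambda>n. sphere_value ((s \<circ> e) (k n))) g"
    unfolding normal_family_on_def by (metis comp_apply)
  then have "strict_mono (e \<circ> k)" "locally_uniform_limit U (\<lambda>n. sphere_value (s ((e \<circ> k) n))) g"
    using e(1) by (auto simp: strict_mono_o)
  then show "\<exists>k g. strict_mono k \<and> locally_uniform_limit U (\<lambda>n. sphere_value (s (k n))) g"
    by blast
qed

theorem corollary3:
  fixes \<alpha> C :: real and f :: "nat \<Rightarrow> complex \<Rightarrow> complex" and D :: "complex set" and z0 :: complex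
  assumes "\<alpha> \<ge> 1" and "C > 0"
    and "D \<noteq> {}" and "open D" and "connected D"
    and "\<And>n. f n nicely_meromorphic_on D"
    and "\<And>n z. z \<in> D \<Longrightarrow> deriv_quotient \<alpha> (f n) z \<ge> ennreal C"
    and "z0 \<in> D"
    and "\<exists>p. (\<forall>n. p n \<in> D) \<and> p \<longlonglongrightarrow> z0 \<and> (\<forall>n. is_pole (f n) (p n))"
  shows "normal_family_at (range f) D z0"
proof -
  obtain p where p: "p \<longlonglongrightarrow> z0" "\<And>n. is_pole (f n) (p n)"
    using assms(9) by blast
  \<comment> \<open>The factor \<open>2\<close> pays for replacing the power \<open>\<alpha>\<close>
    by \<open>1\<close>: for \<open>t \<ge> 0\<close> and \<open>\<alpha> \<ge> 1\<close>,
    \<open>1 + t \<le> 2 * (1 + t powr \<alpha>)\<close>, as the cases \<open>t \<le> 1\<close> and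
    \<open>t > 1\<close> below show.\<close>
  define B where "B = 2 / C"
  have B: "B > 0" using \<open>C > 0\<close> by (simp add: B_def)
  have bound: "1 + norm (f n z) \<le> B * norm (deriv (f n) z)" if "z \<in> D" "\<not> is_pole (f n) z" for n z
  proof -
    let ?P = "1 + norm (f n z) powr \<alpha>"
    have P: "?P > 0" by (simp add: add_pos_nonneg)
    have "ennreal C \<le> ennreal (norm (deriv (f n) z) / ?P)"
      using assms(7)[OF that(1), of n] that(2) by (simp add: deriv_quotient_def)
    then have "C \<le> norm (deriv (f n) z) / ?P"
      using \<open>C > 0\<close> P by (subst (asm) ennreal_le_iff) auto
    then have "C * ?P \<le> norm (deriv (f n) z)"
      using P by (simp add: divide_simps)
    then have "2 / C * (C * ?P) \<le> B * norm (deriv (f n) z)"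
      unfolding B_def using \<open>C > 0\<close> by (intro mult_left_mono) auto
    then have "2 * ?P \<le> B * norm (deriv (f n) z)"
      using \<open>C > 0\<close> by simp
    moreover have "1 + norm (f n z) \<le> 2 * ?P"
    proof (cases "norm (f n z) \<le> 1")
      case True
      then have "1 + norm (f n z) \<le> 2 * 1" by simp
      also have "\<dots> \<le> 2 * ?P" by (intro mult_left_mono) auto
      finally show ?thesis .
    next
      case False
      then have "norm (f n z) powr 1 \<le> norm (f n z) powr \<alpha>"
        using \<open>\<alpha> \<ge> 1\<close> by (intro powr_mono) auto
      then show ?thesis using False by simp
    qed
    ultimately show ?thesis by linarith
  qed
  obtain e where e: "e > 0" "ball z0 e \<subseteq> D"
    using assms(4,8) open_contains_ball by blast
  \<comment> \<open>Halving \<open>e\<close> leaves room in \<open>D\<close> for the Cauchy circles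
    of radius \<open>R\<close> about points of \<open>ball z0 R\<close>.\<close>
  define R where "R = e / 2"
  have R: "R > 0" "ball z0 (2 * R) \<subseteq> D"
    using e by (auto simp: R_def)
  \<comment> \<open>The largest radius meeting both requirements \<open>r \<le> R\<close> and
    \<open>8 * B * r \<le> R\<^sup>2\<close>. It depends only on \<open>e\<close> and
    \<open>C\<close>, not on \<open>n\<close>.\<close>
  define r where "r = min R (R\<^sup>2 / (8 * B))"
  have r: "r > 0" "r \<le> R" "8 * B * r \<le> R\<^sup>2"
    using R B by (auto simp: r_def min_def field_simps)
  have "\<forall>\<^sub>F n in sequentially. p n \<in> ball z0 r"
    using topological_tendstoD[OF p(1) open_ball] r(1) by simp
  then obtain N where N: "\<And>n. n \<ge> N \<Longrightarrow> p n \<in> ball z0 r"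
    unfolding eventually_sequentially by blast
  \<comment> \<open>From \<open>N\<close> on, the pole \<open>p n\<close> lies in
    \<open>ball z0 r\<close>, so the reciprocals share the bound \<open>2 * B / R\<close>.\<close>
  have "normal_family_on (f ` {N..}) (ball z0 r)"
  proof (rule normal_family_on_bounded_reciprocals[OF open_ball])
    fix F assume "F \<in> f ` {N..}"
    then obtain n where n: "n \<ge> N" "F = f n" by auto
    show "\<exists>u. u holomorphic_on ball z0 r \<and>
        (\<forall>z\<in>ball z0 r. norm (u z) \<le> 2 * B / R \<and> sphere_value F z = sphere_inverse (u z))"
      unfolding n(2)
      using nicely_meromorphic_on_subset[OF assms(6) R(2)] R(1) _ B r(2,3) N[OF n(1)] p(2)
      by (rule reciprocal_bounded_near_pole) (use bound R(2) in blast)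
  qed
  moreover have "normal_family_on (f ` {..<N}) (ball z0 r)"
    by (intro normal_family_on_finite) auto
  moreover have "range f = f ` {N..} \<union> f ` {..<N}"
    unfolding image_Un[symmetric] by (rule arg_cong[of _ _ "image f"]) auto
  ultimately have "normal_family_on (range f) (ball z0 r)"
    using normal_family_on_Un by metis
  moreover have "ball z0 r \<subseteq> ball z0 (2 * R)"
    using R(1) r(2) by (intro subset_ball) linarith
  then have "ball z0 r \<subseteq> D"
    using R(2) by (rule order_trans)
  ultimately show ?thesis
    unfolding normal_family_at_def using r(1) by blast
qed

end
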